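(* Whenever all the series concerned are either convergent or terminating, $$\sum_{m,n=0}^\infty\frac{(p,m+n)(p',m+n)(-1)^n x^{m+n}}{(p+p',m+n)(p,m)(p',n)}L_m^{(p-1)}(-y)\,L_n^{(p'-1)}(y)=\Gamma\!\left(\tfrac{p+p'}{2}\right)e^{2xy}(xy)^{1-p/2-p'/2}\,I_{p/2+p'/2-1}(2xy).$$
   Context: Here $p,p'$ are complex parameters and $x,y$ complex variables. $(\alpha,n)=\alpha(\alpha+1)\cdots(\alpha+n-1)$ for $n\ge1$ and $(\alpha,0)=1$ (Pochhammer symbol). $\Gamma$ is the Gamma function. The Laguerre polynomial is $L_n^{(a)}(x)=\frac{(a+1,n)}{n!}\,{}_1F_1[-n;a+1;x]$, where ${}_1F_1[\alpha;\beta;z]=\sum_{k\ge0}\frac{(\alpha,k)}{(\beta,k)}\frac{z^k}{k!}$. $I_\nu(z)=\sum_{k\ge0}\frac{(z/2)^{2k+\nu}}{k!\,\Gamma(\nu+k+1)}$ is the modified Bessel function of the first kind.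
   Formalization: The denominator (p+p',m+n) is corrected to ((p+p')/2,m+n): as printed the x-coefficient is y on the left, 2y on the right. Convergence means absolute convergence of the double series; xy≠0, and p, p', (p+p')/2 are not 0,-1,-2,... *)

theory Defs
  imports "HOL-Analysis.Analysis"
begin

definition hyp1F1 :: "complex \<Rightarrow> complex \<Rightarrow> complex \<Rightarrow> complex" where
  "hyp1F1 a b z = (\<Sum>k. pochhammer a k / pochhammer b k * (z ^ k / fact k))"

definition laguerre :: "nat \<Rightarrow> complex \<Rightarrow> complex \<Rightarrow> complex" where
  "laguerre n a x = pochhammer (a + 1) n / fact n * hyp1F1 (- of_nat n) (a + 1) x"

(* Principal branch of the power (z/2)^(2k+nu); since 0 powr s = 0 for every s, the value
   at z = 0 is meaningless. Where Gamma has a pole the quotient is x / 0 = 0, which agrees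
   with the usual reading of 1/Gamma. *)
definition bessel_I :: "complex \<Rightarrow> complex \<Rightarrow> complex" where
  "bessel_I \<nu> z = (\<Sum>k. (z / 2) powr (2 * of_nat k + \<nu>) / (fact k * Gamma (\<nu> + of_nat k + 1)))"

(* The denominator parameter is (p+p')/2. The identity below is false with p+p' in its
   place: the coefficient of x is then y on the left and 2y on the right. *)
definition lag_term :: "complex \<Rightarrow> complex \<Rightarrow> complex \<Rightarrow> complex \<Rightarrow> nat \<Rightarrow> nat \<Rightarrow> complex" where
  "lag_term p p' x y m n =
     pochhammer p (m + n) * pochhammer p' (m + n) * (- 1) ^ n * x ^ (m + n)
       / (pochhammer ((p + p') / 2) (m + n) * pochhammer p m * pochhammer p' n)
       * laguerre m (p - 1) (- y) * laguerre n (p' - 1) y"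

end

(* Put c = (p + p')/2. Since L_m^(p-1)(-y) / (p,m) and (-1)^n L_n^(p'-1)(y) / (p',n) are the
   coefficients of e^t 0F1[p; ty] and e^(-t) 0F1[p'; ty], the exponentials cancel when the double
   series is summed along a diagonal m + n = N, and Chu-Vandermonde gives the N-th diagonal as
   (2c-1+N, N) (xy)^N / ((c, N) N!). By Kummer's second transformation these add up to
   e^(2xy) 0F1[c; (xy)^2]. Its coefficient form is the expansion of (1+t)^(2s) = (1 + 2t + t^2)^s
   with s = c+N-1; the usual differential equation would leave coefficients undetermined when
   2c-1 is a nonpositive integer. *)
theory Submission
  imports Defs "HOL-Computational_Algebra.Formal_Power_Series"
begin

unbundle no vec_syntax
unbundle fps_syntax

section \<open>Summing a double series along its diagonals\<close>

lemma has_sum_diagonals: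
  fixes f :: "nat \<times> nat \<Rightarrow> 'a::banach"
  assumes "f summable_on UNIV"
  shows "((\<lambda>N. \<Sum>m\<le>N. f (m, N - m)) has_sum infsum f UNIV) UNIV"
proof -
  \<comment> \<open>The fibre over \<open>N\<close> is the finite set of \<open>m\<close> with m
    \<le> N, where \<open>N - m\<close> is an exact difference. Unconditional summability therefore
    passes to the finite fibre sums.\<close>
  have bij: "bij_betw (\<lambda>(N, m). (m, N - m)) (SIGMA N:UNIV. {..N}) (UNIV :: (nat \<times> nat) set)"
    by (rule bij_betw_byWitness[where f' = "\<lambda>(m, n). (m + n, m)"]) auto
  have "(f has_sum infsum f UNIV) UNIV"
    using assms by (rule has_sum_infsum)
  then have "((\<lambda>x. f ((\<lambda>(N, m). (m, N - m)) x)) has_sum infsum f UNIV) (SIGMA N:UNIV. {..N})"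
    by (simp add: has_sum_reindex_bij_betw[OF bij])
  then show ?thesis
    by (rule has_sum_SigmaD) (auto intro: has_sum_finiteI)
qed

lemma pochhammer_nonzero:
  assumes "(a::complex) \<notin> \<int>\<^sub>\<le>\<^sub>0"
  shows "pochhammer a n \<noteq> 0"
  using assms by (auto simp: pochhammer_eq_0_iff)

section \<open>Laguerre polynomials as coefficients of e^t 0F1[a; -wt], and products of 0F1
  series\<close>

definition fps_0F1 :: "complex \<Rightarrow> complex \<Rightarrow> complex fps" where
  "fps_0F1 a w = Abs_fps (\<lambda>k. w ^ k / (fact k * pochhammer a k))"

text \<open>Since (-n,k) = (-1)^k n!/(n-k)! for k \<le> n, the terminating 1F1 is n! times a
  convolution of 1/(n-k)! with the coefficients of 0F1[a; -wt].\<close>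

lemma laguerre_fps_0F1:
  assumes "a \<notin> \<int>\<^sub>\<le>\<^sub>0"
  shows "laguerre n (a - 1) w = pochhammer a n * (fps_exp 1 * fps_0F1 a (- w)) $ n"
proof -
  have poch: "pochhammer (- of_nat n :: complex) k = (- 1) ^ k * fact n / fact (n - k)"
    if "k \<le> n" for k
  proof -
    have "(of_nat (n choose k) :: complex) = (- 1) ^ k * pochhammer (- of_nat n) k / fact k"
      by (simp add: binomial_gbinomial gbinomial_pochhammer)
    moreover have "(of_nat (n choose k) :: complex) = fact n / (fact k * fact (n - k))"
      using that by (rule binomial_fact)
    ultimately have "(- 1) ^ k * pochhammer (- of_nat n) k = (fact n / fact (n - k) :: complex)"
      by (simp add: field_simps)
    then have "(- 1) ^ k * ((- 1) ^ k * pochhammer (- of_nat n) k)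
        = (- 1) ^ k * (fact n / fact (n - k) :: complex)"
      by (rule arg_cong)
    then show ?thesis
      by (simp flip: mult.assoc power_mult_distrib)
  qed
  have "hyp1F1 (- of_nat n) a w
      = (\<Sum>k\<le>n. pochhammer (- of_nat n) k / pochhammer a k * (w ^ k / fact k))"
    unfolding hyp1F1_def by (rule suminf_finite) (auto simp: pochhammer_of_nat_eq_0_iff)
  also have "\<dots> = fact n * (\<Sum>k\<le>n. (- w) ^ k / (fact k * pochhammer a k) * (1 / fact (n - k)))"
    unfolding sum_distrib_left
    by (intro sum.cong refl)
       (simp add: poch pochhammer_nonzero[OF assms] field_simps power_minus[of w])
  also have "\<dots> = fact n * (fps_exp 1 * fps_0F1 a (- w)) $ n"
    by (subst mult.commute[of "fps_exp 1"])
       (simp add: fps_mult_nth fps_0F1_def atLeast0AtMost)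
  finally show ?thesis
    by (simp add: laguerre_def)
qed

text \<open>The sign is the substitution t -> -t in the generating function: it splits over the two
  factors of the product and flips the argument of each.\<close>

lemma laguerre_fps_0F1_alternating:
  assumes "a \<notin> \<int>\<^sub>\<le>\<^sub>0"
  shows "(- 1) ^ n * laguerre n (a - 1) w = pochhammer a n * (fps_exp (- 1) * fps_0F1 a w) $ n"
proof -
  have "(- 1) ^ n * (fps_exp 1 * fps_0F1 a (- w)) $ n = (fps_exp (- 1) * fps_0F1 a w) $ n"
    unfolding fps_mult_nth sum_distrib_left
  proof (intro sum.cong refl)
    fix i assume "i \<in> {0..n}"
    then have "(- 1) ^ n = ((- 1) ^ i * (- 1) ^ (n - i) :: complex)"
      by (simp flip: power_add)
    then show "(- 1) ^ n * (fps_exp 1 $ i * fps_0F1 a (- w) $ (n - i))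
        = fps_exp (- 1) $ i * fps_0F1 a w $ (n - i)"
      by (simp add: fps_0F1_def power_minus[of w])
  qed
  then show ?thesis
    by (simp add: laguerre_fps_0F1[OF assms])
qed

text \<open>After multiplication by (p,n)(q,n), the quotients (p,n)/(p,i) and (q,n)/(q,n-i) are, up
  to factorials, binomial coefficients whose upper entries do not depend on i, so Chu-Vandermonde
  applies.\<close>

lemma fps_0F1_mult_nth:
  assumes p: "p \<notin> \<int>\<^sub>\<le>\<^sub>0" and q: "q \<notin> \<int>\<^sub>\<le>\<^sub>0"
  shows "(fps_0F1 p w * fps_0F1 q w) $ n
    = w ^ n * pochhammer (p + q - 1 + of_nat n) n / (fact n * pochhammer p n * pochhammer q n)"
proof -
  have nz: "pochhammer p k \<noteq> 0" "pochhammer q k \<noteq> 0" for k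
    using assms by (auto simp: pochhammer_nonzero)
  have summand: "pochhammer p n * pochhammer q n * (fps_0F1 p w $ i * fps_0F1 q w $ (n - i))
      = w ^ n * (((q + of_nat n - 1) gchoose i) * ((p + of_nat n - 1) gchoose (n - i)))"
    if "i \<le> n" for i
  proof -
    have P: "pochhammer p n = pochhammer p i * pochhammer (p + of_nat i) (n - i)"
      using that by (rule pochhammer_product)
    have Q: "pochhammer q n = pochhammer q (n - i) * pochhammer (q + of_nat (n - i)) i"
      using pochhammer_product[of "n - i" n q] that by simp
    have "(q + of_nat n - 1) gchoose i = pochhammer (q + of_nat (n - i)) i / fact i"
      using that by (simp add: gbinomial_pochhammer' of_nat_diff algebra_simps)
    moreover have "(p + of_nat n - 1) gchoose (n - i) = pochhammer (p + of_nat i) (n - i) / fact (n - i)"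
      using that by (simp add: gbinomial_pochhammer' of_nat_diff algebra_simps)
    moreover have "w ^ n = w ^ i * w ^ (n - i)"
      using that by (simp flip: power_add)
    ultimately show ?thesis
      by (simp add: fps_0F1_def P Q nz)
  qed
  have "pochhammer p n * pochhammer q n * (fps_0F1 p w * fps_0F1 q w) $ n
      = (\<Sum>i = 0..n. w ^ n * (((q + of_nat n - 1) gchoose i) * ((p + of_nat n - 1) gchoose (n - i))))"
    unfolding fps_mult_nth sum_distrib_left by (intro sum.cong refl summand) simp
  also have "\<dots> = w ^ n * (((q + of_nat n - 1) + (p + of_nat n - 1)) gchoose n)"
    by (simp only: gbinomial_Vandermonde flip: sum_distrib_left)
  also have "\<dots> = w ^ n * pochhammer (p + q - 1 + of_nat n) n / fact n"
    by (simp add: gbinomial_pochhammer' algebra_simps)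
  finally show ?thesis
    using nz by (simp add: field_simps)
qed

section \<open>The coefficient form of Kummer's second transformation\<close>

lemma fps_binomial_double:
  "fps_binomial s oo (2 * fps_X + fps_X ^ 2) = fps_binomial (2 * s :: 'a::field_char_0)"
proof -
  define u :: "'a fps" where "u = 2 * fps_X + fps_X ^ 2"
  define h where "h = fps_binomial s oo u"
  have u0: "u $ 0 = 0"
    by (simp add: u_def)
  have one_u: "1 + u = (1 + fps_X) * (1 + fps_X)"
    by (simp add: u_def algebra_simps power2_eq_square)
  have nz: "(1 + fps_X :: 'a fps) $ 0 \<noteq> 0"
    by simp
  then have nz': "(1 + fps_X :: 'a fps) \<noteq> 0"
    by (metis fps_zero_nth)
  have unit: "(1 + fps_X :: 'a fps) dvd 1"
    by simp
  \<comment> \<open>As 1 + u = (1+X)^2, \<open>h\<close> should be (1+X)^(2s). It is identified by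
    the equation (1+X) h' = 2s h with h(0) = 1, obtained by substituting \<open>u\<close> into the
    equation for (1+X)^s.\<close>
  have "(1 + fps_X) * fps_deriv (fps_binomial s) = fps_const s * fps_binomial s"
    using unit by (simp add: fps_binomial_deriv)
  then have "((1 + fps_X) * fps_deriv (fps_binomial s)) oo u = (fps_const s * fps_binomial s) oo u"
    by simp
  then have K: "(1 + u) * (fps_deriv (fps_binomial s) oo u) = fps_const s * h"
    by (simp only: fps_compose_mult_distrib[OF u0] fps_compose_add_distrib fps_compose_1
        fps_X_fps_compose_startby0[OF u0] fps_const_compose h_def)
  have h': "fps_deriv h = (fps_deriv (fps_binomial s) oo u) * (2 * (1 + fps_X))"
    unfolding h_def fps_compose_deriv[OF u0]
    by (simp add: u_def fps_deriv_power algebra_simps numeral_fps_const)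
  \<comment> \<open>The extra factor 1+X completes 1 + u, so that \<open>K\<close> applies; it is
    cancelled afterwards.\<close>
  have "(1 + fps_X) * ((1 + fps_X) * fps_deriv h)
      = (1 + fps_X) * (2 * ((1 + u) * (fps_deriv (fps_binomial s) oo u)))"
    unfolding one_u h' by (simp only: mult_ac)
  then have "(1 + fps_X) * ((1 + fps_X) * fps_deriv h) = (1 + fps_X) * (2 * (fps_const s * h))"
    by (simp only: K)
  then have "(1 + fps_X) * fps_deriv h = fps_const (2 * s) * h"
    using nz' by (simp add: numeral_fps_const)
  then have "fps_deriv h = fps_const (2 * s) * h / (1 + fps_X)"
    using nz' by (metis nonzero_mult_div_cancel_left)
  moreover have "h $ 0 = 1"
    by (simp add: h_def)
  ultimately show ?thesis
    using fps_binomial_ODE_unique'[of h "2 * s"] by (simp add: h_def u_def)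
qed

lemma gbinomial_double:
  "(2 * s) gchoose N
    = (\<Sum>i\<le>N. (s gchoose i) * (of_nat (i choose (N - i)) * 2 ^ (2 * i - N)) :: 'a::field_char_0)"
proof -
  have coeff: "((2 * fps_X + fps_X ^ 2) ^ i :: 'a fps) $ N
      = of_nat (i choose (N - i)) * 2 ^ (2 * i - N)" if "i \<le> N" for i
  proof -
    have "(2 * fps_X + fps_X ^ 2 :: 'a fps) ^ i = fps_X ^ i * (fps_X + 2) ^ i"
      by (simp add: power2_eq_square algebra_simps flip: power_mult_distrib)
    also have "(fps_X + 2 :: 'a fps) ^ i
        = (\<Sum>k\<le>i. fps_const (of_nat (i choose k) * 2 ^ (i - k)) * fps_X ^ k)"
      unfolding binomial_ring
      by (intro sum.cong refl)
         (simp add: numeral_fps_const fps_of_nat[symmetric] mult_ac flip: fps_const_power fps_const_mult)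
    finally have "((2 * fps_X + fps_X ^ 2) ^ i :: 'a fps) $ N
        = (\<Sum>k\<le>i. if N - i = k then of_nat (i choose k) * 2 ^ (i - k) else 0)"
      using that by (simp add: fps_X_power_mult_nth fps_sum_nth if_distrib cong: if_cong)
    \<comment> \<open>If 2i < N, then N - i > i and the binomial coefficient vanishes, so the
      truncated difference \<open>2 * i - N\<close> does no harm.\<close>
    also have "\<dots> = of_nat (i choose (N - i)) * 2 ^ (2 * i - N)"
      using that by (auto simp: mult_2 binomial_eq_0)
    finally show ?thesis .
  qed
  have "(2 * s) gchoose N = (fps_binomial s oo (2 * fps_X + fps_X ^ 2)) $ N"
    by (simp add: fps_binomial_double)
  also have "\<dots> = (\<Sum>i\<le>N. (s gchoose i) * (of_nat (i choose (N - i)) * 2 ^ (2 * i - N)))"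
    unfolding fps_compose_nth by (intro sum.cong) (auto simp: coeff atLeast0AtMost)
  finally show ?thesis .
qed

text \<open>This is \<open>gbinomial_double\<close> at s = c+N-1, divided by (c,N). The right-hand
  side is the coefficient of z^N in e^(2z) 0F1[c; z^2]; the parity test is there because the second
  factor is even in z.\<close>

lemma kummer_second_coeff:
  fixes c :: complex
  assumes c: "c \<notin> \<int>\<^sub>\<le>\<^sub>0"
  shows "pochhammer (2 * c - 1 + of_nat N) N / (pochhammer c N * fact N)
    = (\<Sum>i\<le>N. 2 ^ i / fact i * (if even (N - i)
         then 1 / (fact ((N - i) div 2) * pochhammer c ((N - i) div 2)) else 0))"
proof -
  define s where "s = c + of_nat N - 1"
  define g where "g i = (s gchoose i) * (of_nat (i choose (N - i)) * 2 ^ (2 * i - N))" for i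
  note nz = pochhammer_nonzero[OF c]
  \<comment> \<open>Here (s choose N-k) = (c+k, N-k)/(N-k)!, and dividing by (c,N) = (c,k)(c+k, N-k)
    leaves 1/(c,k).\<close>
  have eq: "g (N - k) / pochhammer c N
      = 2 ^ (N - 2 * k) / fact (N - 2 * k) * (1 / (fact k * pochhammer c k))" if "2 * k \<le> N" for k
  proof -
    have "s gchoose (N - k) = pochhammer (c + of_nat k) (N - k) / fact (N - k)"
      using that by (simp add: s_def gbinomial_pochhammer' of_nat_diff algebra_simps)
    moreover have "pochhammer c N = pochhammer c k * pochhammer (c + of_nat k) (N - k)"
      using that by (intro pochhammer_product) simp
    moreover have "(of_nat ((N - k) choose k) :: complex) = fact (N - k) / (fact k * fact (N - 2 * k))"
      using that binomial_fact[of k "N - k", where ?'a = complex] by (simp add: mult_2)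
    moreover have "2 * (N - k) - N = N - 2 * k"
      by simp
    ultimately show ?thesis
      using that nz[of N] by (simp add: g_def)
  qed
  have "pochhammer (2 * c - 1 + of_nat N) N / (pochhammer c N * fact N)
      = ((2 * s) gchoose N) / pochhammer c N"
    by (simp add: s_def gbinomial_pochhammer' algebra_simps)
  also have "\<dots> = (\<Sum>i\<le>N. g i / pochhammer c N)"
    by (simp add: gbinomial_double g_def sum_divide_distrib)
  also have "\<dots> = (\<Sum>i\<le>N. 2 ^ i / fact i * (if even (N - i)
         then 1 / (fact ((N - i) div 2) * pochhammer c ((N - i) div 2)) else 0))"
  proof -
    let ?h = "\<lambda>i. 2 ^ i / fact i * (if even (N - i)
         then 1 / (fact ((N - i) div 2) * pochhammer c ((N - i) div 2)) else 0)"
    have "(\<Sum>i\<le>N. g i / pochhammer c N) = (\<Sum>i | i \<le> N \<and> N \<le> 2 * i. g i / pochhammer c N)"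
      by (rule sum.mono_neutral_right) (auto simp: g_def binomial_eq_0)
    also have "\<dots> = (\<Sum>i | i \<le> N \<and> even (N - i). ?h i)"
    \<comment> \<open>The binomial index i = N - k goes to the index N - 2k = 2i - N of the
      exponential series.\<close>
    proof (rule sum.reindex_bij_witness[where i = "\<lambda>i. N - (N - i) div 2" and j = "\<lambda>i. 2 * i - N"])
      fix i assume "i \<in> {i. i \<le> N \<and> N \<le> 2 * i}"
      then have i: "i \<le> N" "N \<le> 2 * i" by auto
      have half: "N - (2 * i - N) = 2 * (N - i)" "N - 2 * (N - i) = 2 * i - N"
        using i by simp_all
      show "N - (N - (2 * i - N)) div 2 = i"
        and "2 * i - N \<in> {i. i \<le> N \<and> even (N - i)}"
        and "?h (2 * i - N) = g i / pochhammer c N"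
        using i eq[of "N - i"] by (simp_all add: half)
    next
      fix i assume "i \<in> {i. i \<le> N \<and> even (N - i)}"
      then obtain k where "i \<le> N" "N - i = 2 * k" by blast
      then show "2 * (N - (N - i) div 2) - N = i"
        and "N - (N - i) div 2 \<in> {i. i \<le> N \<and> N \<le> 2 * i}"
        by auto
    qed
    also have "\<dots> = (\<Sum>i\<le>N. ?h i)"
      by (rule sum.mono_neutral_left) auto
    finally show ?thesis .
  qed
  finally show ?thesis .
qed

section \<open>Convergence of 0F1 and the analytic form of Kummer's transformation\<close>

lemma summable_norm_0F1:
  fixes c w :: complex
  assumes c: "c \<notin> \<int>\<^sub>\<le>\<^sub>0"
  shows "summable (\<lambda>k. norm (w ^ k / (fact k * pochhammer c k)))"
proof -
  \<comment> \<open>From this index on, |c+k| \<ge> 1 and 1+k \<ge> 2|w|, so the ratio of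
    consecutive terms is at most 1/2.\<close>
  define N where "N = nat \<lceil>max (norm c + 1) (2 * norm w)\<rceil>"
  show ?thesis
  proof (rule summable_ratio_test[where c = "1/2" and N = N])
    fix k assume "k \<ge> N"
    then have k: "real k \<ge> norm c + 1" "real k \<ge> 2 * norm w"
      unfolding N_def by linarith+
    have "norm (of_nat k :: complex) \<le> norm (c + of_nat k) + norm c"
      by (metis add_diff_cancel_left' norm_triangle_ineq4)
    then have "1 \<le> norm (c + of_nat k)"
      using k by simp
    then have "2 * norm w \<le> (1 + real k) * norm (c + of_nat k)"
      using k mult_mono[of "2 * norm w" "1 + real k" 1 "norm (c + of_nat k)"] by simp
    moreover have "0 < (1 + real k) * norm (c + of_nat k)"
      using \<open>1 \<le> norm (c + of_nat k)\<close> by (intro mult_pos_pos) linarith+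
    ultimately have ratio: "norm w / ((1 + real k) * norm (c + of_nat k)) \<le> 1 / 2"
      by (simp add: field_simps)
    have "norm (w ^ Suc k / (fact (Suc k) * pochhammer c (Suc k)))
        = norm w / ((1 + real k) * norm (c + of_nat k)) * norm (w ^ k / (fact k * pochhammer c k))"
      by (simp add: norm_mult norm_divide norm_power pochhammer_Suc mult_ac)
         (metis norm_of_nat of_nat_Suc)
    also have "\<dots> \<le> 1 / 2 * norm (w ^ k / (fact k * pochhammer c k))"
      using ratio by (rule mult_right_mono) simp
    finally show "norm (norm (w ^ Suc k / (fact (Suc k) * pochhammer c (Suc k))))
        \<le> 1 / 2 * norm (norm (w ^ k / (fact k * pochhammer c k)))"
      by simp
  qed simp
qed

text \<open>Kummer's second transformation
  \<open>1F1[c - 1/2; 2c - 1; 4z] = exp (2z) 0F1[c; z\<^sup>2]\<close>. The coefficients of the left-hand side are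
  written so that \<open>2c - 1\<close> may be a nonpositive integer.\<close>

lemma kummer_second_sums:
  fixes c z :: complex
  assumes c: "c \<notin> \<int>\<^sub>\<le>\<^sub>0"
  shows "(\<lambda>N. z ^ N * pochhammer (2 * c - 1 + of_nat N) N / (pochhammer c N * fact N))
    sums (exp (2 * z) * (\<Sum>k. z ^ (2 * k) / (fact k * pochhammer c k)))"
proof -
  define a where "a i = (2 * z) ^ i / fact i" for i
  \<comment> \<open>Padding 0F1[c; z^2] with zero odd terms makes it a series in powers of z, so
    that its Cauchy product with the exponential series is graded by z^N.\<close>
  define b where "b j = (if even j then z ^ j / (fact (j div 2) * pochhammer c (j div 2)) else 0)" for j
  have mono: "strict_mono (\<lambda>k::nat. 2 * k)"
    by (simp add: strict_mono_def)
  have odd_b: "b n = 0" if "n \<notin> range (\<lambda>k. 2 * k)" for n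
    using that by (auto simp: b_def elim: evenE)
  have b_even: "b (2 * k) = z ^ (2 * k) / (fact k * pochhammer c k)" for k
    by (simp add: b_def)
  have sum_a: "summable (\<lambda>i. norm (a i))"
    using summable_norm_exp[of "2 * z"] by (simp add: a_def scaleR_conv_of_real field_simps)
  have "summable (\<lambda>k. norm (b (2 * k)))"
    using summable_norm_0F1[OF c, of "z ^ 2"] by (simp add: b_even power_mult)
  then have sum_b: "summable (\<lambda>j. norm (b j))"
    using summable_mono_reindex[OF mono, of "\<lambda>j. norm (b j)"] odd_b by simp
  have "(\<Sum>i. a i) = exp (2 * z)"
    by (simp add: a_def exp_def scaleR_conv_of_real field_simps)
  moreover have "(\<Sum>j. b j) = (\<Sum>k. z ^ (2 * k) / (fact k * pochhammer c k))"
    using suminf_mono_reindex[OF mono, of b] odd_b by (simp add: b_even)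
  moreover have "(\<Sum>i\<le>N. a i * b (N - i))
      = z ^ N * pochhammer (2 * c - 1 + of_nat N) N / (pochhammer c N * fact N)" for N
  proof -
    have "(\<Sum>i\<le>N. a i * b (N - i)) = z ^ N * (\<Sum>i\<le>N. 2 ^ i / fact i * (if even (N - i)
         then 1 / (fact ((N - i) div 2) * pochhammer c ((N - i) div 2)) else 0))"
      unfolding sum_distrib_left
    proof (intro sum.cong refl)
      fix i assume "i \<in> {..N}"
      then have "z ^ N = z ^ i * z ^ (N - i)"
        by (simp flip: power_add)
      then show "a i * b (N - i) = z ^ N * (2 ^ i / fact i * (if even (N - i)
         then 1 / (fact ((N - i) div 2) * pochhammer c ((N - i) div 2)) else 0))"
        by (simp add: a_def b_def power_mult_distrib)
    qed
    then show ?thesis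
      by (simp only: kummer_second_coeff[OF c, symmetric] times_divide_eq_right)
  qed
  ultimately show ?thesis
    using Cauchy_product_sums[OF sum_a sum_b] by simp
qed

section \<open>The Bessel function, the diagonal sums and the final identity\<close>

lemma bessel_I_0F1:
  assumes c: "c \<notin> \<int>\<^sub>\<le>\<^sub>0" and z: "z \<noteq> 0"
  shows "Gamma c * z powr (1 - c) * bessel_I (c - 1) (2 * z)
    = (\<Sum>k. z ^ (2 * k) / (fact k * pochhammer c k))"
proof -
  have G: "Gamma c \<noteq> 0"
    using c by (simp add: Gamma_eq_zero_iff)
  \<comment> \<open>Both powers use the same branch of the logarithm of the nonzero number
    \<open>z\<close>, so the branch choice cancels.\<close>
  have powr1: "z powr (1 - c) * z powr (c - 1) = 1"
    using z by (simp flip: powr_add)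
  have "(2 * z / 2) powr (2 * of_nat k + (c - 1)) / (fact k * Gamma (c - 1 + of_nat k + 1))
      = z powr (c - 1) / Gamma c * (z ^ (2 * k) / (fact k * pochhammer c k))" for k
  proof -
    have "z powr (2 * of_nat k + (c - 1)) = z ^ (2 * k) * z powr (c - 1)"
      using z powr_nat[of z "2 * k"] by (simp add: powr_add)
    moreover have "Gamma (c - 1 + of_nat k + 1) = Gamma c * pochhammer c k"
      using G by (simp add: pochhammer_Gamma[OF c])
    ultimately show ?thesis by (simp add: mult_ac)
  qed
  then have "bessel_I (c - 1) (2 * z)
      = (\<Sum>k. z powr (c - 1) / Gamma c * (z ^ (2 * k) / (fact k * pochhammer c k)))"
    by (simp only: bessel_I_def)
  also have "\<dots> = z powr (c - 1) / Gamma c * (\<Sum>k. z ^ (2 * k) / (fact k * pochhammer c k))"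
  proof (rule suminf_mult)
    show "summable (\<lambda>k. z ^ (2 * k) / (fact k * pochhammer c k))"
      using summable_norm_cancel[OF summable_norm_0F1[OF c, of "z ^ 2"]] by (simp add: power_mult)
  qed
  finally show ?thesis
    using G powr1 by (simp add: mult_ac flip: mult.assoc)
qed

text \<open>On a diagonal the factors depending on m+n form the constant \<open>A\<close>. What
  remains is a coefficient of the product of the two Laguerre generating functions, whose
  exponentials cancel; (p,N)(q,N) then cancels the denominator from
  \<open>fps_0F1_mult_nth\<close>.\<close>

lemma lag_term_diagonal_sum:
  assumes p: "p \<notin> \<int>\<^sub>\<le>\<^sub>0" and q: "q \<notin> \<int>\<^sub>\<le>\<^sub>0"
  shows "(\<Sum>m\<le>N. lag_term p q x y m (N - m))
    = (x * y) ^ N * pochhammer (p + q - 1 + of_nat N) N / (pochhammer ((p + q) / 2) N * fact N)"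
proof -
  define A where "A = pochhammer p N * pochhammer q N * x ^ N / pochhammer ((p + q) / 2) N"
  define E where "E = fps_exp 1 * fps_0F1 p y"
  define F where "F = fps_exp (- 1) * fps_0F1 q y"
  note nz = pochhammer_nonzero[OF p] pochhammer_nonzero[OF q]
  have "lag_term p q x y m (N - m) = A * (E $ m * F $ (N - m))" if "m \<le> N" for m
  proof -
    have "lag_term p q x y m (N - m) = A * (laguerre m (p - 1) (- y) / pochhammer p m)
        * ((- 1) ^ (N - m) * laguerre (N - m) (q - 1) y / pochhammer q (N - m))"
      using that by (simp add: lag_term_def A_def)
    then show ?thesis
      by (simp add: laguerre_fps_0F1[OF p] laguerre_fps_0F1_alternating[OF q] nz E_def F_def)
  qed
  then have "(\<Sum>m\<le>N. lag_term p q x y m (N - m)) = A * (E * F) $ N"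
    by (simp add: fps_mult_nth sum_distrib_left atLeast0AtMost)
  also have "E * F = (fps_exp 1 * fps_exp (- 1)) * (fps_0F1 p y * fps_0F1 q y)"
    by (simp only: E_def F_def mult_ac)
  also have "fps_exp 1 * fps_exp (- 1) = (1 :: complex fps)"
    by (simp flip: fps_exp_add_mult)
  finally show ?thesis
    using nz[of N] by (simp add: fps_0F1_mult_nth[OF p q] A_def power_mult_distrib)
qed

text \<open>The excluded parameter values keep all Pochhammer denominators nonzero. If
  \<open>x * y\<close> were 0, the convention \<open>0 powr s = 0\<close> would make the right-hand
  side 0, whereas the diagonals add up to 1.\<close>

theorem mainTheorem3:
  fixes p p' x y :: complex
  assumes "p \<notin> \<int>\<^sub>\<le>\<^sub>0" and "p' \<notin> \<int>\<^sub>\<le>\<^sub>0" and "(p + p') / 2 \<notin> \<int>\<^sub>\<le>\<^sub>0"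
    and "x * y \<noteq> 0"
    and "(\<lambda>(m, n). lag_term p p' x y m n) summable_on UNIV"
  shows "(\<Sum>\<^sub>\<infinity>(m, n)\<in>UNIV. lag_term p p' x y m n)
    = Gamma ((p + p') / 2) * exp (2 * x * y) * (x * y) powr (1 - p / 2 - p' / 2)
        * bessel_I (p / 2 + p' / 2 - 1) (2 * x * y)"
proof -
  define c where "c = (p + p') / 2"
  have c: "c \<notin> \<int>\<^sub>\<le>\<^sub>0"
    using assms(3) by (simp add: c_def)
  have c_eq: "(p + p') / 2 = c" "p + p' = 2 * c" "1 - p / 2 - p' / 2 = 1 - c" "p / 2 + p' / 2 - 1 = c - 1"
    by (simp_all add: c_def field_simps)
  have "(\<lambda>N. \<Sum>m\<le>N. lag_term p p' x y m (N - m)) sums (\<Sum>\<^sub>\<infinity>(m, n)\<in>UNIV. lag_term p p' x y m n)"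
    using has_sum_imp_sums[OF has_sum_diagonals[OF assms(5)]] by simp
  moreover have "(\<lambda>N. \<Sum>m\<le>N. lag_term p p' x y m (N - m))
      sums (exp (2 * (x * y)) * (\<Sum>k. (x * y) ^ (2 * k) / (fact k * pochhammer c k)))"
    using kummer_second_sums[OF c, of "x * y"]
    by (simp add: lag_term_diagonal_sum[OF assms(1,2)] c_eq)
  ultimately have "(\<Sum>\<^sub>\<infinity>(m, n)\<in>UNIV. lag_term p p' x y m n)
      = exp (2 * (x * y)) * (\<Sum>k. (x * y) ^ (2 * k) / (fact k * pochhammer c k))"
    by (rule sums_unique2)
  then show ?thesis
    unfolding c_eq using bessel_I_0F1[OF c assms(4)] by (simp add: mult_ac)
qed

end
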